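(* Let $\mathbb{F}$ be a field of characteristic zero, let $A,B\in M_n(\mathbb{F})$ and $\omega\in\mathbb{F}$. Then $\mathcal{C}_\omega(A)=\mathcal{C}_\omega(B)$ if and only if there exists $P\in GL_{n^2}(\mathbb{F})$ such that $$I_n\otimes A-\omega A^T\otimes I_n=P\,(I_n\otimes B-\omega B^T\otimes I_n).$$
   Context: For $A\in M_n(\mathbb{F})$ and $\omega\in\mathbb{F}$, the $\omega$-centralizer of $A$ is $\mathcal{C}_\omega(A)=\{X\in M_n(\mathbb{F})\mid AX=\omega XA\}$. $\otimes$ is the Kronecker product of matrices, $I_n$ is the $n\times n$ identity matrix, and $GL_{n^2}(\mathbb{F})$ is the group of invertible $n^2\times n^2$ matrices over $\mathbb{F}$. *)

theory Defs
  imports "Jordan_Normal_Form.Matrix"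
begin

definition omega_centralizer :: "nat \<Rightarrow> 'a :: comm_ring_1 \<Rightarrow> 'a mat \<Rightarrow> 'a mat set" where
  "omega_centralizer n \<omega> A = {X \<in> carrier_mat n n. A * X = \<omega> \<cdot>\<^sub>m (X * A)}"

text \<open>The block at position (k, l) of the Kronecker product is the matrix B scaled by
  the (k, l) entry of A.\<close>
definition kronecker_product :: "'a :: comm_ring_1 mat \<Rightarrow> 'a mat \<Rightarrow> 'a mat" (infixl "\<otimes>\<^sub>K" 75) where
  "A \<otimes>\<^sub>K B = mat (dim_row A * dim_row B) (dim_col A * dim_col B)
     (\<lambda>(i, j). A $$ (i div dim_row B, j div dim_col B) * B $$ (i mod dim_row B, j mod dim_col B))"

definition GL :: "nat \<Rightarrow> 'a :: comm_ring_1 mat set" where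
  "GL m = {P \<in> carrier_mat m m. invertible_mat P}"

end

theory Submission
  imports Defs "Jordan_Normal_Form.Determinant"
begin

text \<open>Stacking the columns of X into one long vector turns the linear map that sends X to
  \<open>A * X - \<omega> \<cdot>\<^sub>m (X * A)\<close> into multiplication by the \<open>n\<^sup>2\<close> by \<open>n\<^sup>2\<close> matrix
  on the left-hand side of the equation (\<open>vectorize_in_kernel_iff\<close>). So the
  \<open>\<omega>\<close>-centralizer of A is the kernel of that matrix, and what remains is a fact about
  arbitrary square matrices M and N over a field: they have the same kernel if and only if M
  arises from N by left multiplication with an invertible matrix (\<open>same_kernel_iff_GL\<close>).

  An invertible left factor does not change the kernel, which is one direction. For the
  other one, row operations make any square matrix idempotent, as in the Hermite normal
  form, the reduced row echelon form whose rows are moved so that the pivots lie on the diagonal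
  (\<open>GL_times_mat_idempotent\<close>). So M and N may be replaced by idempotents E and F with the same
  kernel. The images of 1 - E and 1 - F are this common kernel, hence EF = E and FE = F.
  Then (E - F)F = E - F gives (1 + E - F)F = E, and \<open>(E - F)\<^sup>2 = 0\<close> makes 1 + E - F
  invertible with inverse 1 - E + F (\<open>idempotents_same_kernel_GL\<close>).\<close>

section \<open>Invertible matrices\<close>

lemma GL_I:
  fixes P :: "'a :: field mat"
  assumes P: "P \<in> carrier_mat m m" and Q: "Q \<in> carrier_mat m m" and PQ: "P * Q = 1\<^sub>m m"
  shows "P \<in> GL m"
proof -
  have "Q * P = 1\<^sub>m m"
    using mat_mult_left_right_inverse[OF P Q PQ] .
  then show ?thesis
    using P Q PQ unfolding GL_def invertible_mat_def inverts_mat_def by auto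
qed

lemma GL_E:
  assumes "P \<in> GL m"
  obtains Q where "P \<in> carrier_mat m m" "Q \<in> carrier_mat m m" "P * Q = 1\<^sub>m m" "Q * P = 1\<^sub>m m"
proof -
  from assms obtain Q where P: "P \<in> carrier_mat m m"
    and Q: "P * Q = 1\<^sub>m m" "Q * P = 1\<^sub>m (dim_row Q)"
    unfolding GL_def invertible_mat_def inverts_mat_def by auto
  have "dim_col (P * Q) = m" "dim_col (Q * P) = dim_row Q"
    unfolding Q by simp_all
  with P have "Q \<in> carrier_mat m m" by auto
  with P Q that show thesis by auto
qed

lemma GL_mult:
  fixes P Q :: "'a :: field mat"
  assumes "P \<in> GL m" and "Q \<in> GL m"
  shows "P * Q \<in> GL m"
proof -
  obtain P' where P: "P \<in> carrier_mat m m" "P' \<in> carrier_mat m m" "P * P' = 1\<^sub>m m"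
    using assms(1) by (rule GL_E)
  obtain Q' where Q: "Q \<in> carrier_mat m m" "Q' \<in> carrier_mat m m" "Q * Q' = 1\<^sub>m m"
    using assms(2) by (rule GL_E)
  have "(P * Q) * (Q' * P') = P * ((Q * Q') * P')"
    using P(1,2) Q(1,2) by (simp add: assoc_mult_mat[of _ m m _ m _ m])
  also have "\<dots> = 1\<^sub>m m"
    using P Q by simp
  finally show ?thesis
    using GL_I[of "P * Q" m "Q' * P'"] P Q by simp
qed

lemma GL_one: "(1\<^sub>m m :: 'a :: field mat) \<in> GL m"
  by (rule GL_I[of _ _ "1\<^sub>m m"]) auto

definition rank_one_mat :: "'a :: semiring_0 vec \<Rightarrow> 'a vec \<Rightarrow> 'a mat" where
  "rank_one_mat u w = mat (dim_vec u) (dim_vec w) (\<lambda>(i, j). u $ i * w $ j)"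

lemma rank_one_mat_carrier [simp]:
  "u \<in> carrier_vec m \<Longrightarrow> w \<in> carrier_vec n \<Longrightarrow> rank_one_mat u w \<in> carrier_mat m n"
  unfolding rank_one_mat_def by auto

lemma rank_one_mat_mult:
  fixes u w :: "'a :: field vec"
  assumes "u \<in> carrier_vec m" "w \<in> carrier_vec n" "M \<in> carrier_mat n k" "a < m" "j < k"
  shows "(rank_one_mat u w * M) $$ (a, j) = u $ a * (w \<bullet> col M j)"
  using assms
  by (auto simp: rank_one_mat_def scalar_prod_def sum_distrib_left mult.assoc intro!: sum.cong)

text \<open>The square of a rank one matrix is a multiple of itself, so the inverse can be found
  among the matrices of the form identity plus multiple of the rank one part (the
  Sherman--Morrison formula).\<close>
lemma one_plus_rank_one_GL:
  fixes u w :: "'a :: field vec"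
  assumes u: "u \<in> carrier_vec m" and w: "w \<in> carrier_vec m" and ne: "1 + w \<bullet> u \<noteq> 0"
  shows "1\<^sub>m m + rank_one_mat u w \<in> GL m"
proof -
  define U where "U = rank_one_mat u w"
  define c where "c = inverse (1 + w \<bullet> u)"
  have U: "U \<in> carrier_mat m m"
    using u w unfolding U_def by simp
  have UU: "U * U = (w \<bullet> u) \<cdot>\<^sub>m U"
  proof (rule eq_matI)
    fix a j assume "a < dim_row ((w \<bullet> u) \<cdot>\<^sub>m U)" "j < dim_col ((w \<bullet> u) \<cdot>\<^sub>m U)"
    then have aj: "a < m" "j < m" using U by auto
    have "col U j = w $ j \<cdot>\<^sub>v u"
      using aj u w by (intro eq_vecI) (auto simp: U_def rank_one_mat_def)
    then have "(U * U) $$ (a, j) = u $ a * (w \<bullet> (w $ j \<cdot>\<^sub>v u))"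
      using rank_one_mat_mult[OF u w U aj] unfolding U_def by metis
    also have "\<dots> = (w \<bullet> u) * U $$ (a, j)"
      using aj u w by (simp add: U_def rank_one_mat_def)
    finally show "(U * U) $$ (a, j) = ((w \<bullet> u) \<cdot>\<^sub>m U) $$ (a, j)"
      using aj U by simp
  qed (use U in auto)
  have "(1\<^sub>m m + U) * (1\<^sub>m m - c \<cdot>\<^sub>m U) = (1\<^sub>m m + U) - c \<cdot>\<^sub>m (U + U * U)"
    using U
    by (simp add: mult_minus_distrib_mat[of _ m m _ m] add_mult_distrib_mat[of _ m m _ _ m]
        mult_smult_distrib[of _ m m _ m])
  also have "\<dots> = 1\<^sub>m m"
  proof (rule eq_matI)
    fix a j assume "a < dim_row (1\<^sub>m m :: 'a mat)" "j < dim_col (1\<^sub>m m :: 'a mat)"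
    then have aj: "a < m" "j < m" by auto
    have "c * (1 + w \<bullet> u) = 1" using ne by (simp add: c_def)
    then have "c * (U $$ (a, j) + (w \<bullet> u) * U $$ (a, j)) = U $$ (a, j)"
      by (metis mult.assoc mult_1 distrib_right)
    then show "((1\<^sub>m m + U) - c \<cdot>\<^sub>m (U + U * U)) $$ (a, j) = 1\<^sub>m m $$ (a, j)"
      using aj U unfolding UU by simp
  qed (use U in auto)
  finally show ?thesis
    using GL_I[of "1\<^sub>m m + U" m "1\<^sub>m m - c \<cdot>\<^sub>m U"] U unfolding U_def
    by (simp add: minus_carrier_mat)
qed

section \<open>Invertible times idempotent\<close>

text \<open>The key step of row reduction: once the columns in S are unit vectors, a further
  column that sticks out of their span can also be made a unit vector without disturbing them.
  The row operation is the rank one update that sends v to the k-th unit vector, where the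
  functional w vanishes on the unit vectors indexed by S and takes the value 1 at v; it is
  invertible as soon as the k-th entry of w is nonzero.\<close>
lemma extend_unit_columns:
  fixes R :: "'a :: field mat"
  assumes R: "R \<in> carrier_mat m m" and S: "\<And>i. i \<in> S \<Longrightarrow> i < m \<and> col R i = unit_vec m i"
    and k: "k < m" "k \<notin> S" and l: "l < m" "l \<notin> S" "R $$ (l, k) \<noteq> 0"
  obtains T where "T \<in> GL m" "\<And>i. i \<in> insert k S \<Longrightarrow> col (T * R) i = unit_vec m i"
proof -
  define v where "v = col R k"
  have v: "v \<in> carrier_vec m" and vl: "v $ l \<noteq> 0"
    using R k l unfolding v_def by auto
  obtain w where w: "w \<in> carrier_vec m" "w \<bullet> v = 1" "w $ k \<noteq> 0" "\<And>i. i \<in> S \<Longrightarrow> w $ i = 0"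
  proof (cases "v $ k = 0")
    case False
    show thesis
      by (rule that[of "inverse (v $ k) \<cdot>\<^sub>v unit_vec m k"]) (use False v k S in auto)
  next
    \<comment> \<open>The summand at l gives the value 1 at v; the summand at k, which does not see v, makes
      the k-th entry nonzero.\<close>
    case True
    then have "l \<noteq> k" using vl by auto
    show thesis
      by (rule that[of "inverse (v $ l) \<cdot>\<^sub>v unit_vec m l + unit_vec m k"])
        (use True v k l vl S \<open>l \<noteq> k\<close> in
          \<open>auto simp: add_scalar_prod_distrib[of _ m]\<close>)
  qed
  define u where "u = unit_vec m k - v"
  have u: "u \<in> carrier_vec m" using v unfolding u_def by auto
  have "1 + w \<bullet> u = w $ k"
    using v w(1,2) k unfolding u_def by (simp add: scalar_prod_minus_distrib[of _ m])
  then have GL: "1\<^sub>m m + rank_one_mat u w \<in> GL m" (is "?T \<in> _")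
    using one_plus_rank_one_GL[OF u w(1)] w(3) by simp
  have U: "rank_one_mat u w \<in> carrier_mat m m" using u w(1) by simp
  have entry: "(?T * R) $$ (a, j) = R $$ (a, j) + u $ a * (w \<bullet> col R j)" if "a < m" "j < m" for a j
  proof -
    have "?T * R = R + rank_one_mat u w * R"
      using U R by (simp add: add_mult_distrib_mat[of _ m m _ _ m])
    then show ?thesis
      using rank_one_mat_mult[OF u w(1) R that] U R that by simp
  qed
  have "col (?T * R) i = unit_vec m i" if i: "i \<in> insert k S" for i
  proof (rule eq_vecI)
    fix a assume "a < dim_vec (unit_vec m i :: 'a vec)"
    then have a: "a < m" by simp
    have im: "i < m" using i S k by auto
    have ca: "R $$ (a, i) = col R i $ a" using a im R by simp
    show "col (?T * R) i $ a = unit_vec m i $ a"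
    proof (cases "i = k")
      case True
      then show ?thesis
        using entry[OF a im] a im R U v w(2) ca unfolding u_def v_def by simp
    next
      case False
      then have "i \<in> S" using i by simp
      then have "w \<bullet> col R i = 0" using S w(1,4) by simp
      then show ?thesis
        using entry[OF a im] a im R U S[OF \<open>i \<in> S\<close>] ca by simp
    qed
  qed (use U R in simp)
  with GL that show thesis by blast
qed

text \<open>Choose the invertible factor so that as many columns as possible of the product become the
  unit vector with the same index. By the preceding lemma every column is then supported on the
  indices of these unit columns, hence is fixed by the product, which is therefore
  idempotent.\<close>
lemma GL_times_mat_idempotent:
  fixes M :: "'a :: field mat"
  assumes M: "M \<in> carrier_mat m m"
  obtains P where "P \<in> GL m" "(P * M) * (P * M) = P * M"
proof -
  define unit_columns where
    "unit_columns = (\<lambda>P. {i. i < m \<and> col (P * M) i = unit_vec m i})"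
  have fin: "finite (unit_columns P)" for P
    unfolding unit_columns_def by simp
  have "card (unit_columns P) < Suc m" for P
    using card_mono[of "{..<m}" "unit_columns P"] unfolding unit_columns_def
    by (auto simp: less_Suc_eq_le)
  then obtain P where P: "P \<in> GL m"
    and max: "\<And>P'. P' \<in> GL m \<Longrightarrow> card (unit_columns P') \<le> card (unit_columns P)"
    using ex_has_greatest_nat[of "\<lambda>P. P \<in> GL m" "1\<^sub>m m" "\<lambda>P. card (unit_columns P)" "Suc m"] GL_one
    by blast
  define R where "R = P * M"
  define S where "S = unit_columns P"
  have Pc: "P \<in> carrier_mat m m" using P unfolding GL_def by simp
  then have R: "R \<in> carrier_mat m m" using M unfolding R_def by simp
  have S: "i < m \<and> col R i = unit_vec m i" if "i \<in> S" for i
    using that unfolding S_def unit_columns_def R_def by simp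
  have supp: "R $$ (l, k) = 0" if k: "k < m" "k \<notin> S" and l: "l < m" "l \<notin> S" for k l
  proof (rule ccontr)
    assume "R $$ (l, k) \<noteq> 0"
    then obtain T where T: "T \<in> GL m" "\<And>i. i \<in> insert k S \<Longrightarrow> col (T * R) i = unit_vec m i"
      using extend_unit_columns[OF R S k l] by blast
    have "T * R = (T * P) * M"
      using T(1) Pc M unfolding R_def GL_def by (simp add: assoc_mult_mat[of _ m m _ m _ m])
    then have "insert k S \<subseteq> unit_columns (T * P)"
      using T(2) S k unfolding unit_columns_def by auto
    then have "card (insert k S) \<le> card (unit_columns (T * P))"
      by (rule card_mono[OF fin])
    also have "\<dots> \<le> card S"
      using max[OF GL_mult[OF T(1) P]] unfolding S_def .
    finally show False
      using k fin[of P] unfolding S_def by simp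
  qed
  have unit_entry: "R $$ (a, i) = (if a = i then 1 else 0)" if "a < m" "i \<in> S" for a i
  proof -
    have "R $$ (a, i) = unit_vec m i $ a"
      using that S R by (metis index_col carrier_matD)
    then show ?thesis using that S by simp
  qed
  have zero_entry: "R $$ (i, j) = 0" if "i < m" "i \<notin> S" "j < m" for i j
    using that supp unit_entry by (cases "j \<in> S") auto
  have "R * R = R"
  proof (rule eq_matI)
    fix a j assume "a < dim_row R" "j < dim_col R"
    then have aj: "a < m" "j < m" using R by auto
    have "(R * R) $$ (a, j) = (\<Sum>i = 0..<m. R $$ (a, i) * R $$ (i, j))"
      using aj R by (simp add: scalar_prod_def)
    also have "\<dots> = (\<Sum>i = 0..<m. if i = a then R $$ (i, j) else 0)"
      using aj unit_entry zero_entry by (intro sum.cong refl) (metis atLeastLessThan_iff mult_1 mult_zero_left mult_zero_right)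
    also have "\<dots> = R $$ (a, j)" using aj by simp
    finally show "(R * R) $$ (a, j) = R $$ (a, j)" .
  qed (use R in auto)
  with P that show thesis unfolding R_def by blast
qed

section \<open>Matrices with the same kernel\<close>

lemma mult_mat_vec_GL_eq_0_iff:
  fixes P M :: "'a :: field mat"
  assumes "P \<in> GL m" "M \<in> carrier_mat m m" "v \<in> carrier_vec m"
  shows "(P * M) *\<^sub>v v = 0\<^sub>v m \<longleftrightarrow> M *\<^sub>v v = 0\<^sub>v m"
proof -
  obtain Q where P: "P \<in> carrier_mat m m" and Q: "Q \<in> carrier_mat m m" "Q * P = 1\<^sub>m m"
    using assms(1) by (rule GL_E)
  have Mv: "M *\<^sub>v v \<in> carrier_vec m" using assms(2,3) by simp
  have eq: "(P * M) *\<^sub>v v = P *\<^sub>v (M *\<^sub>v v)"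
    using P assms(2,3) by simp
  have "Q *\<^sub>v (P *\<^sub>v (M *\<^sub>v v)) = M *\<^sub>v v"
    using P Q Mv by (metis assoc_mult_mat_vec one_mult_mat_vec)
  moreover have "P *\<^sub>v 0\<^sub>v m = 0\<^sub>v m" "Q *\<^sub>v 0\<^sub>v m = 0\<^sub>v m"
    using P Q by auto
  ultimately show ?thesis unfolding eq by metis
qed

text \<open>Each vector v differs from F v by an element of the kernel of the idempotent F.\<close>
lemma mult_idempotent_of_kernel_subset:
  fixes E F :: "'a :: field mat"
  assumes E: "E \<in> carrier_mat m m" and F: "F \<in> carrier_mat m m" and FF: "F * F = F"
    and ker: "\<And>v. v \<in> carrier_vec m \<Longrightarrow> F *\<^sub>v v = 0\<^sub>v m \<Longrightarrow> E *\<^sub>v v = 0\<^sub>v m"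
  shows "E * F = E"
proof -
  define D where "D = 1\<^sub>m m - F"
  have D: "D \<in> carrier_mat m m" using F unfolding D_def by auto
  have FD: "F * D = 0\<^sub>m m m"
    using F FF unfolding D_def by (simp add: mult_minus_distrib_mat[of _ m m _ m])
  have "E * D = 0\<^sub>m m m"
  proof (rule eq_matI)
    fix a j assume "a < dim_row (0\<^sub>m m m :: 'a mat)" "j < dim_col (0\<^sub>m m m :: 'a mat)"
    then have aj: "a < m" "j < m" by auto
    have "F *\<^sub>v col D j = 0\<^sub>v m"
      using aj F D FD col_mult2[of F m m D m j] by simp
    then have "col (E * D) j = 0\<^sub>v m"
      using aj E D col_mult2[of E m m D m j] ker[of "col D j"] by auto
    then show "(E * D) $$ (a, j) = 0\<^sub>m m m $$ (a, j)"
      using aj E D by (metis index_col index_zero_vec(1) index_zero_mat(1) carrier_matD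
          index_mult_mat(2,3))
  qed (use E D in auto)
  then have eq: "E - E * F = 0\<^sub>m m m"
    using E F unfolding D_def by (simp add: mult_minus_distrib_mat[of _ m m _ m])
  show ?thesis
  proof (rule eq_matI)
    fix a j assume "a < dim_row E" "j < dim_col E"
    then have aj: "a < m" "j < m" using E by auto
    have "(E - E * F) $$ (a, j) = 0" using aj unfolding eq by simp
    then show "(E * F) $$ (a, j) = E $$ (a, j)" using aj E F by simp
  qed (use E F in auto)
qed

text \<open>Two idempotents with the same kernel satisfy EF = E and FE = F. So the difference
  E - F has square zero, and 1 + E - F is an invertible matrix that takes F to E.\<close>
lemma idempotents_same_kernel_GL:
  fixes E F :: "'a :: field mat"
  assumes E: "E \<in> carrier_mat m m" "E * E = E" and F: "F \<in> carrier_mat m m" "F * F = F"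
    and ker: "\<And>v. v \<in> carrier_vec m \<Longrightarrow> E *\<^sub>v v = 0\<^sub>v m \<longleftrightarrow> F *\<^sub>v v = 0\<^sub>v m"
  obtains G where "G \<in> GL m" "E = G * F"
proof -
  have EF: "E * F = E" and FE: "F * E = F"
    using mult_idempotent_of_kernel_subset[of E m F] mult_idempotent_of_kernel_subset[of F m E]
      E F ker by blast+
  define D where "D = E - F"
  have D: "D \<in> carrier_mat m m" using E F unfolding D_def by auto
  have DE: "D * E = D" and DF: "D * F = D"
    using E F EF FE unfolding D_def by (simp_all add: minus_mult_distrib_mat[of _ m m _ _ m])
  have "D * D = D * E - D * F"
    using E F D by (subst (2) D_def) (simp add: mult_minus_distrib_mat[of _ m m _ m])
  then have DD: "D * D = 0\<^sub>m m m"
    using D unfolding DE DF by simp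
  have "(1\<^sub>m m + D) * (1\<^sub>m m - D) = (1\<^sub>m m - D) + D"
    using D DD
    by (simp add: add_mult_distrib_mat[of _ m m _ _ m] mult_minus_distrib_mat[of _ m m _ m])
      (auto simp: minus_carrier_mat intro!: eq_matI)
  also have "\<dots> = 1\<^sub>m m"
    using D by (auto intro!: eq_matI)
  finally have "1\<^sub>m m + D \<in> GL m"
    using GL_I[OF _ minus_carrier_mat[OF D]] D by auto
  moreover have "(1\<^sub>m m + D) * F = F + D"
    using D F DF by (simp add: add_mult_distrib_mat[of _ m m _ _ m])
  moreover have "F + D = E"
    using E F unfolding D_def by (auto intro!: eq_matI)
  ultimately show thesis using that by metis
qed

text \<open>Both matrices are reduced to idempotents by invertible left factors, which leave the
  kernels unchanged and can be moved to the other side afterwards.\<close>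
lemma same_kernel_iff_GL:
  fixes M N :: "'a :: field mat"
  assumes M: "M \<in> carrier_mat m m" and N: "N \<in> carrier_mat m m"
  shows "(\<forall>v \<in> carrier_vec m. M *\<^sub>v v = 0\<^sub>v m \<longleftrightarrow> N *\<^sub>v v = 0\<^sub>v m) \<longleftrightarrow> (\<exists>P \<in> GL m. M = P * N)"
proof
  assume ker: "\<forall>v \<in> carrier_vec m. M *\<^sub>v v = 0\<^sub>v m \<longleftrightarrow> N *\<^sub>v v = 0\<^sub>v m"
  obtain P where P: "P \<in> GL m" "(P * M) * (P * M) = P * M"
    using M by (rule GL_times_mat_idempotent)
  obtain Q where Q: "Q \<in> GL m" "(Q * N) * (Q * N) = Q * N"
    using N by (rule GL_times_mat_idempotent)
  obtain P' where Pc: "P \<in> carrier_mat m m" and P': "P' \<in> carrier_mat m m"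
    and PP': "P * P' = 1\<^sub>m m" "P' * P = 1\<^sub>m m"
    using P(1) by (rule GL_E)
  have P'_GL: "P' \<in> GL m" using GL_I[OF P' Pc PP'(2)] .
  have Qc: "Q \<in> carrier_mat m m" using Q(1) unfolding GL_def by simp
  obtain G where G: "G \<in> GL m" "P * M = G * (Q * N)"
  proof (rule idempotents_same_kernel_GL[of "P * M" m "Q * N"])
    show "(P * M) *\<^sub>v v = 0\<^sub>v m \<longleftrightarrow> (Q * N) *\<^sub>v v = 0\<^sub>v m" if "v \<in> carrier_vec m" for v
      using ker that mult_mat_vec_GL_eq_0_iff[OF P(1) M that]
        mult_mat_vec_GL_eq_0_iff[OF Q(1) N that] by blast
  qed (use Pc Qc M N P(2) Q(2) in auto)
  have Gc: "G \<in> carrier_mat m m" using G(1) unfolding GL_def by simp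
  have "M = (P' * P) * M" using M PP' by simp
  also have "\<dots> = P' * (G * (Q * N))"
    using assoc_mult_mat[OF P' Pc M] unfolding G(2) .
  also have "\<dots> = (P' * (G * Q)) * N"
    using P' Gc Qc N by (simp add: assoc_mult_mat[of _ m m _ m _ m])
  finally show "\<exists>P \<in> GL m. M = P * N"
    using GL_mult[OF P'_GL GL_mult[OF G(1) Q(1)]] by blast
next
  assume "\<exists>P \<in> GL m. M = P * N"
  then show "\<forall>v \<in> carrier_vec m. M *\<^sub>v v = 0\<^sub>v m \<longleftrightarrow> N *\<^sub>v v = 0\<^sub>v m"
    using mult_mat_vec_GL_eq_0_iff[OF _ N] by blast
qed

section \<open>Vectorization\<close>

text \<open>Columns are stacked on top of each other, so that the entry at position (l, k) sits at
  index \<open>k * n + l\<close>, in line with the block structure of the Kronecker product.\<close>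
definition vectorize :: "nat \<Rightarrow> 'a mat \<Rightarrow> 'a vec" where
  "vectorize n X = vec (n\<^sup>2) (\<lambda>q. X $$ (q mod n, q div n))"

lemma vectorize_carrier [simp]: "vectorize n X \<in> carrier_vec (n\<^sup>2)"
  unfolding vectorize_def by simp

lemma index_square:
  fixes n k l :: nat
  assumes "k < n" "l < n"
  shows "k * n + l < n\<^sup>2" "(k * n + l) div n = k" "(k * n + l) mod n = l"
proof -
  have "k * n + l < Suc k * n" using assms by simp
  also have "\<dots> \<le> n * n" using assms by (intro mult_le_mono1) simp
  finally show "k * n + l < n\<^sup>2" by (simp add: power2_eq_square)
qed (use assms in auto)

lemma div_mod_square:
  fixes n q :: nat
  assumes "q < n\<^sup>2"
  shows "q div n < n" "q mod n < n"
proof -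
  have "n \<noteq> 0" using assms by (cases n) auto
  then show "q div n < n" "q mod n < n"
    using assms by (simp_all add: power2_eq_square less_mult_imp_div_less)
qed

lemma vectorize_index:
  "k < n \<Longrightarrow> l < n \<Longrightarrow> vectorize n X $ (k * n + l) = X $$ (l, k)"
  by (simp add: vectorize_def index_square)

lemma vectorize_eq_iff:
  assumes X: "X \<in> carrier_mat n n" and Y: "Y \<in> carrier_mat n n"
  shows "vectorize n X = vectorize n Y \<longleftrightarrow> X = Y"
proof
  assume eq: "vectorize n X = vectorize n Y"
  show "X = Y"
  proof (rule eq_matI)
    fix l k assume "l < dim_row Y" "k < dim_col Y"
    then show "X $$ (l, k) = Y $$ (l, k)"
      using vectorize_index[of k n l X] vectorize_index[of k n l Y] eq Y by simp
  qed (use X Y in auto)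
qed simp

lemma vectorize_surj:
  assumes "v \<in> carrier_vec (n\<^sup>2)"
  obtains X where "X \<in> carrier_mat n n" "vectorize n X = v"
proof
  let ?X = "mat n n (\<lambda>(l, k). v $ (k * n + l))"
  show "vectorize n ?X = v"
    using assms div_mod_square[of _ n] by (intro eq_vecI) (auto simp: vectorize_def)
qed simp

lemma sum_square:
  fixes g :: "nat \<Rightarrow> 'a :: comm_monoid_add"
  shows "(\<Sum>q = 0..<n\<^sup>2. g q) = (\<Sum>k = 0..<n. \<Sum>l = 0..<n. g (k * n + l))"
proof -
  have "(\<Sum>l = 0..<n. g (k * n + l)) = sum g {k * n..<k * n + n}" for k
    using sum.shift_bounds_nat_ivl[of g 0 "k * n" n] by (simp add: add.commute)
  then show ?thesis
    using sum.nat_group[of g n n] by (simp add: atLeast0LessThan power2_eq_square)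
qed

lemma kronecker_product_carrier [simp]:
  "C \<in> carrier_mat n n \<Longrightarrow> D \<in> carrier_mat n n \<Longrightarrow> C \<otimes>\<^sub>K D \<in> carrier_mat (n\<^sup>2) (n\<^sup>2)"
  unfolding kronecker_product_def by (auto simp: power2_eq_square)

lemma kronecker_mult_vectorize:
  fixes C D X :: "'a :: comm_ring_1 mat"
  assumes C: "C \<in> carrier_mat n n" and D: "D \<in> carrier_mat n n" and X: "X \<in> carrier_mat n n"
  shows "(C \<otimes>\<^sub>K D) *\<^sub>v vectorize n X = vectorize n (D * X * transpose_mat C)"
proof (rule eq_vecI)
  fix p assume "p < dim_vec (vectorize n (D * X * transpose_mat C))"
  then have p: "p < n\<^sup>2" by (simp add: vectorize_def)
  define k l where "k = p div n" and "l = p mod n"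
  have kl: "k < n" "l < n" using div_mod_square[OF p] unfolding k_def l_def by auto
  have "((C \<otimes>\<^sub>K D) *\<^sub>v vectorize n X) $ p
      = (\<Sum>q = 0..<n\<^sup>2. (C \<otimes>\<^sub>K D) $$ (p, q) * vectorize n X $ q)"
    using p kronecker_product_carrier[OF C D]
    by (auto simp: scalar_prod_def vectorize_def intro!: sum.cong)
  also have "\<dots> = (\<Sum>k' = 0..<n. \<Sum>l' = 0..<n. C $$ (k, k') * D $$ (l, l') * X $$ (l', k'))"
    unfolding sum_square
  proof (intro sum.cong refl)
    fix k' l' assume "k' \<in> {0..<n}" "l' \<in> {0..<n}"
    then have kl': "k' < n" "l' < n" by auto
    then show "(C \<otimes>\<^sub>K D) $$ (p, k' * n + l') * vectorize n X $ (k' * n + l')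
        = C $$ (k, k') * D $$ (l, l') * X $$ (l', k')"
      using C D p index_square[OF kl'] vectorize_index[OF kl', of X]
      by (simp add: kronecker_product_def k_def l_def power2_eq_square)
  qed
  also have "\<dots> = (D * X * transpose_mat C) $$ (l, k)"
    using C D X kl
    by (simp add: scalar_prod_def sum_distrib_left sum_distrib_right mult_ac)
      (rule sum.swap)
  finally show "((C \<otimes>\<^sub>K D) *\<^sub>v vectorize n X) $ p
      = vectorize n (D * X * transpose_mat C) $ p"
    using p by (simp add: vectorize_def k_def l_def)
qed (use kronecker_product_carrier[OF C D] in \<open>simp add: vectorize_def\<close>)

text \<open>Under vectorization this is the matrix of the linear map that sends X to
  \<open>A * X - \<omega> \<cdot>\<^sub>m (X * A)\<close>. The transpose compensates for the one in
  \<open>kronecker_mult_vectorize\<close>.\<close>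
abbreviation omega_commutator_mat :: "nat \<Rightarrow> 'a :: comm_ring_1 \<Rightarrow> 'a mat \<Rightarrow> 'a mat" where
  "omega_commutator_mat n \<omega> A \<equiv> 1\<^sub>m n \<otimes>\<^sub>K A - (\<omega> \<cdot>\<^sub>m transpose_mat A) \<otimes>\<^sub>K 1\<^sub>m n"

lemma omega_commutator_mat_carrier:
  "A \<in> carrier_mat n n \<Longrightarrow> omega_commutator_mat n \<omega> A \<in> carrier_mat (n\<^sup>2) (n\<^sup>2)"
  by (intro minus_carrier_mat kronecker_product_carrier) auto

lemma vectorize_in_kernel_iff:
  fixes A X :: "'a :: field mat"
  assumes A: "A \<in> carrier_mat n n" and X: "X \<in> carrier_mat n n"
  shows "omega_commutator_mat n \<omega> A *\<^sub>v vectorize n X = 0\<^sub>v (n\<^sup>2)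
    \<longleftrightarrow> X \<in> omega_centralizer n \<omega> A"
proof -
  have "(1\<^sub>m n \<otimes>\<^sub>K A) *\<^sub>v vectorize n X = vectorize n (A * X)"
    using A X by (simp add: kronecker_mult_vectorize)
  moreover have "((\<omega> \<cdot>\<^sub>m transpose_mat A) \<otimes>\<^sub>K 1\<^sub>m n) *\<^sub>v vectorize n X
      = vectorize n (\<omega> \<cdot>\<^sub>m (X * A))"
  proof -
    have "transpose_mat (\<omega> \<cdot>\<^sub>m transpose_mat A) = \<omega> \<cdot>\<^sub>m A"
      by (intro eq_matI) auto
    then show ?thesis
      using A X by (simp add: kronecker_mult_vectorize mult_smult_distrib[of _ n n _ n])
  qed
  ultimately have "omega_commutator_mat n \<omega> A *\<^sub>v vectorize n X
      = vectorize n (A * X) - vectorize n (\<omega> \<cdot>\<^sub>m (X * A))"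
    using A by (simp add: minus_mult_distrib_mat_vec[of _ "n\<^sup>2" "n\<^sup>2"])
  moreover have "v - w = 0\<^sub>v (n\<^sup>2) \<longleftrightarrow> v = w"
    if "v \<in> carrier_vec (n\<^sup>2)" "w \<in> carrier_vec (n\<^sup>2)" for v w :: "'a vec"
    using that by (auto simp: vec_eq_iff)
  ultimately have "omega_commutator_mat n \<omega> A *\<^sub>v vectorize n X = 0\<^sub>v (n\<^sup>2)
      \<longleftrightarrow> vectorize n (A * X) = vectorize n (\<omega> \<cdot>\<^sub>m (X * A))"
    by simp
  also have "\<dots> \<longleftrightarrow> A * X = \<omega> \<cdot>\<^sub>m (X * A)"
    using A X by (intro vectorize_eq_iff) auto
  finally show ?thesis
    using X unfolding omega_centralizer_def by simp
qed

lemma omega_centralizer_eq_iff_same_kernel: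
  fixes A B :: "'a :: field mat"
  assumes A: "A \<in> carrier_mat n n" and B: "B \<in> carrier_mat n n"
  shows "omega_centralizer n \<omega> A = omega_centralizer n \<omega> B \<longleftrightarrow>
    (\<forall>v \<in> carrier_vec (n\<^sup>2). omega_commutator_mat n \<omega> A *\<^sub>v v = 0\<^sub>v (n\<^sup>2)
      \<longleftrightarrow> omega_commutator_mat n \<omega> B *\<^sub>v v = 0\<^sub>v (n\<^sup>2))" (is "?L \<longleftrightarrow> ?R")
proof
  assume ?L
  show ?R
  proof
    fix v :: "'a vec" assume "v \<in> carrier_vec (n\<^sup>2)"
    then obtain X where "X \<in> carrier_mat n n" "vectorize n X = v" by (rule vectorize_surj)
    then show "omega_commutator_mat n \<omega> A *\<^sub>v v = 0\<^sub>v (n\<^sup>2)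
        \<longleftrightarrow> omega_commutator_mat n \<omega> B *\<^sub>v v = 0\<^sub>v (n\<^sup>2)"
      using vectorize_in_kernel_iff[OF A] vectorize_in_kernel_iff[OF B] \<open>?L\<close> by metis
  qed
next
  assume ?R
  then have "X \<in> omega_centralizer n \<omega> A \<longleftrightarrow> X \<in> omega_centralizer n \<omega> B"
    if "X \<in> carrier_mat n n" for X
    using vectorize_in_kernel_iff[OF A that] vectorize_in_kernel_iff[OF B that]
      vectorize_carrier by metis
  moreover have "omega_centralizer n \<omega> C \<subseteq> carrier_mat n n" for C :: "'a mat"
    unfolding omega_centralizer_def by auto
  ultimately show ?L by blast
qed

theorem theorem4p2:
  fixes A B :: "'a :: field_char_0 mat" and \<omega> :: 'a and n :: nat
  assumes "A \<in> carrier_mat n n" and "B \<in> carrier_mat n n"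
  shows "omega_centralizer n \<omega> A = omega_centralizer n \<omega> B \<longleftrightarrow>
    (\<exists>P \<in> GL (n\<^sup>2).
      1\<^sub>m n \<otimes>\<^sub>K A - (\<omega> \<cdot>\<^sub>m transpose_mat A) \<otimes>\<^sub>K 1\<^sub>m n =
      P * (1\<^sub>m n \<otimes>\<^sub>K B - (\<omega> \<cdot>\<^sub>m transpose_mat B) \<otimes>\<^sub>K 1\<^sub>m n))"
  using omega_centralizer_eq_iff_same_kernel[OF assms]
    same_kernel_iff_GL[OF omega_commutator_mat_carrier[OF assms(1)]
      omega_commutator_mat_carrier[OF assms(2)]]
  by blast

end
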